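(* The problems RCB Testing and Matroid Intersection Reconfiguration require an exponential number of independence queries if the matroids are given by independence oracles.
   Context: A common basis of two matroids over a common ground set is a set that is a basis of both. A pair of matroids $M_1$ and $M_2$ over a common (finite) ground set satisfies (RCB) (Reconfigurability of Common Bases) if for any pair of common bases $B$ and $B'$ of $M_1$ and $M_2$ there exists a sequence $B_0,B_1,\dots,B_\ell$ of common bases of $M_1$ and $M_2$ such that $B_0=B$, $B_\ell=B'$, and $|B_{i-1}\setminus B_i|=|B_i\setminus B_{i-1}|=1$ for each $i\in\{1,\dots,\ell\}$. RCB Testing is the following problem: given two matroids $M_1$ and $M_2$ (over a common ground set), determine whether $M_1$ and $M_2$ satisfy (RCB). Matroid Intersection Reconfiguration is the following problem: given two matroids $M_1$ and $M_2$ (over a common ground set) and their common bases $B$ and $B'$, determine whether $B$ can be transformed into $B'$ by exchanging a pair of elements repeatedly (i.e., in each step adding one element and removing another) so that all the intermediate sets are common bases of $M_1$ and $M_2$. An independence oracle for a matroid $M$ on ground set $E$ answers, for a queried set $X\subseteq E$, whether $X$ is independent in $M$; each such question is an independence query. *)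

theory Defs
  imports Complex_Main
begin

text \<open>A matroid on the finite ground set \<open>E\<close> is given by its independence predicate \<open>indep\<close>.\<close>

locale matroid =
  fixes E :: "'a set" and indep :: "'a set \<Rightarrow> bool"
  assumes finite_ground: "finite E"
    and indep_subset_ground: "indep X \<Longrightarrow> X \<subseteq> E"
    and indep_empty: "indep {}"
    and indep_subset: "indep X \<Longrightarrow> Y \<subseteq> X \<Longrightarrow> indep Y"
    and augment: "indep X \<Longrightarrow> indep Y \<Longrightarrow> card X < card Y \<Longrightarrow> \<exists>y\<in>Y - X. indep (insert y X)"

definition basis :: "('a set \<Rightarrow> bool) \<Rightarrow> 'a set \<Rightarrow> bool" where
  "basis indep B \<longleftrightarrow> indep B \<and> (\<forall>X. indep X \<and> B \<subseteq> X \<longrightarrow> X = B)"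

definition common_basis :: "('a set \<Rightarrow> bool) \<Rightarrow> ('a set \<Rightarrow> bool) \<Rightarrow> 'a set \<Rightarrow> bool" where
  "common_basis I1 I2 B \<longleftrightarrow> basis I1 B \<and> basis I2 B"

definition reconfigurable ::
  "('a set \<Rightarrow> bool) \<Rightarrow> ('a set \<Rightarrow> bool) \<Rightarrow> 'a set \<Rightarrow> 'a set \<Rightarrow> bool" where
  "reconfigurable I1 I2 B B' \<longleftrightarrow>
     (\<exists>(l::nat) S. S 0 = B \<and> S l = B' \<and> (\<forall>i\<le>l. common_basis I1 I2 (S i)) \<and>
        (\<forall>i\<in>{1..l}. card (S (i - 1) - S i) = 1 \<and> card (S i - S (i - 1)) = 1))"

definition RCB :: "('a set \<Rightarrow> bool) \<Rightarrow> ('a set \<Rightarrow> bool) \<Rightarrow> bool" where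
  "RCB I1 I2 \<longleftrightarrow>
     (\<forall>B B'. common_basis I1 I2 B \<longrightarrow> common_basis I1 I2 B' \<longrightarrow> reconfigurable I1 I2 B B')"

text \<open>
  A deterministic adaptive algorithm, on a fixed ground set and with the rest of its explicit input
  fixed, is a decision tree: it stops with a yes/no answer, or asks whether a set is independent in
  the first or the second matroid and continues depending on the reply. Computation between queries
  is free. Trees are finite along every branch; this excludes no algorithm that halts on all pairs
  of matroids, since there are only finitely many pairs on a finite ground set and branches
  reached by none of them can be cut off. Queries are not required to be subsets of the ground set;
  for other sets the reply is negative and carries no information.
\<close>

datatype 'a query_algorithm =
    Answer bool
  | Query1 "'a set" "bool \<Rightarrow> 'a query_algorithm"
  | Query2 "'a set" "bool \<Rightarrow> 'a query_algorithm"

primrec answer :: "('a set \<Rightarrow> bool) \<Rightarrow> ('a set \<Rightarrow> bool) \<Rightarrow> 'a query_algorithm \<Rightarrow> bool" where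
  "answer I1 I2 (Answer b) = b"
| "answer I1 I2 (Query1 X k) = answer I1 I2 (k (I1 X))"
| "answer I1 I2 (Query2 X k) = answer I1 I2 (k (I2 X))"

primrec num_queries :: "('a set \<Rightarrow> bool) \<Rightarrow> ('a set \<Rightarrow> bool) \<Rightarrow> 'a query_algorithm \<Rightarrow> nat" where
  "num_queries I1 I2 (Answer b) = 0"
| "num_queries I1 I2 (Query1 X k) = Suc (num_queries I1 I2 (k (I1 X)))"
| "num_queries I1 I2 (Query2 X k) = Suc (num_queries I1 I2 (k (I2 X)))"

definition solves_RCB_testing :: "'a set \<Rightarrow> 'a query_algorithm \<Rightarrow> bool" where
  "solves_RCB_testing E A \<longleftrightarrow>
     (\<forall>I1 I2. matroid E I1 \<longrightarrow> matroid E I2 \<longrightarrow> (answer I1 I2 A \<longleftrightarrow> RCB I1 I2))"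

text \<open>
  The two common bases are explicit input, so the decision tree may depend on them; nothing is
  required when the two given sets are not common bases.
\<close>

definition solves_matroid_intersection_reconfiguration ::
  "'a set \<Rightarrow> ('a set \<Rightarrow> 'a set \<Rightarrow> 'a query_algorithm) \<Rightarrow> bool" where
  "solves_matroid_intersection_reconfiguration E A \<longleftrightarrow>
     (\<forall>I1 I2 B B'. matroid E I1 \<longrightarrow> matroid E I2 \<longrightarrow>
        common_basis I1 I2 B \<longrightarrow> common_basis I1 I2 B' \<longrightarrow>
        (answer I1 I2 (A B B') \<longleftrightarrow> reconfigurable I1 I2 B B'))"

end

theory Submission
  imports Defs
begin

text \<open>
  Let \<open>M\<^sub>1\<close> be the partition matroid whose bases are the transversals of \<open>2 m\<close> disjoint pairs, so that
  the basis exchange graph of \<open>M\<^sub>1\<close> is a hypercube. Two transversals on the same level of the cube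
  differ in at least two exchanges, so declaring all transversals of the middle level dependent
  gives a sparse paving matroid \<open>M\<^sub>2\<close>. The common bases are then the cube without its middle level,
  whose lower and upper halves are disconnected. Turning any single middle transversal into a basis
  of \<open>M\<^sub>2\<close> makes all common bases mutually reachable, and the only query detecting this change is the
  one about that transversal. Hence an algorithm must query all \<open>2 m choose m\<close> of them.
\<close>

subsection \<open>Queries\<close>

text \<open>Only the second oracle is recorded, because the instances compared later share their
  first matroid. Being a set, it counts a repeated query once.\<close>

primrec queried2 :: "('a set \<Rightarrow> bool) \<Rightarrow> ('a set \<Rightarrow> bool) \<Rightarrow> 'a query_algorithm \<Rightarrow> 'a set set" where
  "queried2 I1 I2 (Answer b) = {}"
| "queried2 I1 I2 (Query1 X k) = queried2 I1 I2 (k (I1 X))"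
| "queried2 I1 I2 (Query2 X k) = insert X (queried2 I1 I2 (k (I2 X)))"

lemma finite_queried2: "finite (queried2 I1 I2 A)"
  by (induction A) auto

lemma card_queried2_le: "card (queried2 I1 I2 A) \<le> num_queries I1 I2 A"
proof (induction A)
  case (Query2 X k)
  have "card (queried2 I1 I2 (Query2 X k)) \<le> Suc (card (queried2 I1 I2 (k (I2 X))))"
    by (simp add: card_insert_if finite_queried2)
  with Query2[OF rangeI, of "I2 X"] show ?case by simp
qed (auto intro: le_SucI)

text \<open>If \<open>J\<close> gives the replies of \<open>I2\<close> to all queries made on
  \<open>I1\<close>, \<open>I2\<close>, then both runs follow the same branch of the tree.\<close>

lemma answer_cong_queried2:
  "(\<And>X. X \<in> queried2 I1 I2 A \<Longrightarrow> J X = I2 X) \<Longrightarrow> answer I1 J A = answer I1 I2 A"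
  by (induction A) auto

text \<open>The adversary argument: if altering the reply at \<open>X\<close> alone can flip the
  answer, the run on \<open>I1\<close>, \<open>I2\<close> must have queried \<open>X\<close>. So all
  of \<open>F\<close> is queried.\<close>

lemma card_le_num_queries:
  assumes "\<And>X. X \<in> F \<Longrightarrow>
    \<exists>J. (\<forall>Y. Y \<noteq> X \<longrightarrow> J Y = I2 Y) \<and> answer I1 J A \<noteq> answer I1 I2 A"
  shows "card F \<le> num_queries I1 I2 A"
proof -
  have "F \<subseteq> queried2 I1 I2 A"
    using assms answer_cong_queried2 by (metis subsetI)
  then have "card F \<le> card (queried2 I1 I2 A)"
    by (simp add: card_mono finite_queried2)
  then show ?thesis
    using card_queried2_le le_trans by blast
qed

subsection \<open>Reconfiguration sequences\<close>

lemma reconfigurable_refl: "common_basis I1 I2 B \<Longrightarrow> reconfigurable I1 I2 B B"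
  unfolding reconfigurable_def by (intro exI[of _ 0] exI[of _ "\<lambda>_. B"]) auto

lemma reconfigurable_imp_common_basis: "reconfigurable I1 I2 B C \<Longrightarrow> common_basis I1 I2 B"
  unfolding reconfigurable_def by (metis zero_le)

lemma reconfigurable_step:
  assumes "reconfigurable I1 I2 B C" "common_basis I1 I2 D" "card (C - D) = 1" "card (D - C) = 1"
  shows "reconfigurable I1 I2 B D"
proof -
  obtain l :: nat and S where S: "S 0 = B" "S l = C" "\<forall>i\<le>l. common_basis I1 I2 (S i)"
    "\<forall>i\<in>{1..l}. card (S (i - 1) - S i) = 1 \<and> card (S i - S (i - 1)) = 1"
    using assms(1) unfolding reconfigurable_def by blast
  show ?thesis
    unfolding reconfigurable_def
  proof (intro exI[of _ "Suc l"] exI[of _ "S(Suc l := D)"] conjI ballI)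
    show "\<forall>i\<le>Suc l. common_basis I1 I2 ((S(Suc l := D)) i)"
      using S(3) assms(2) by (auto simp: le_Suc_eq)
    fix i assume "i \<in> {1..Suc l}"
    then consider "i = Suc l" | "i \<in> {1..l}" by fastforce
    note * = this
    from * show "card ((S(Suc l := D)) (i - 1) - (S(Suc l := D)) i) = 1"
      by cases (use S assms in auto)
    from * show "card ((S(Suc l := D)) i - (S(Suc l := D)) (i - 1)) = 1"
      by cases (use S assms in auto)
  qed (use S in auto)
qed

text \<open>Induction along a sequence, stated as a rule. Taking reachability for \<open>P\<close>
  gives transitivity and symmetry; taking a bound on the level in the cube gives
  unreachability.\<close>

lemma reconfigurable_invariant:
  assumes "reconfigurable I1 I2 B B'" and "P B"
    and step: "\<And>C D. \<lbrakk>P C; common_basis I1 I2 C; common_basis I1 I2 D;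
      card (C - D) = 1; card (D - C) = 1\<rbrakk> \<Longrightarrow> P D"
  shows "P B'"
proof -
  obtain l :: nat and S where S: "S 0 = B" "S l = B'" "\<forall>i\<le>l. common_basis I1 I2 (S i)"
    "\<forall>i\<in>{1..l}. card (S (i - 1) - S i) = 1 \<and> card (S i - S (i - 1)) = 1"
    using assms(1) unfolding reconfigurable_def by blast
  have "i \<le> l \<Longrightarrow> P (S i)" for i
  proof (induction i)
    case 0
    then show ?case using S(1) \<open>P B\<close> by simp
  next
    case (Suc i)
    then show ?case
      using step[of "S i" "S (Suc i)"] S(3) S(4)[rule_format, of "Suc i"] by simp
  qed
  then show ?thesis using S(2) by blast
qed

lemma reconfigurable_trans:
  assumes "reconfigurable I1 I2 B C" "reconfigurable I1 I2 C D"
  shows "reconfigurable I1 I2 B D"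
  using assms(2,1)
  by (rule reconfigurable_invariant) (blast intro: reconfigurable_step)

lemma reconfigurable_sym:
  assumes "reconfigurable I1 I2 B C"
  shows "reconfigurable I1 I2 C B"
  using assms
proof (rule reconfigurable_invariant)
  show "reconfigurable I1 I2 B B"
    using assms by (intro reconfigurable_refl reconfigurable_imp_common_basis)
  fix C D
  assume "reconfigurable I1 I2 C B" and CD: "common_basis I1 I2 C" "common_basis I1 I2 D"
    "card (C - D) = 1" "card (D - C) = 1"
  \<comment> \<open>The two cardinality conditions exchange roles when the step is reversed.\<close>
  moreover have "reconfigurable I1 I2 D C"
    using CD by (blast intro: reconfigurable_refl reconfigurable_step)
  ultimately show "reconfigurable I1 I2 D B"
    using reconfigurable_trans by blast
qed

subsection \<open>Partition matroids and sparse paving matroids\<close>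

text \<open>The fibres of \<open>p\<close> on \<open>U\<close> are classes of capacity one, and
  elements of \<open>E - U\<close> are loops. For augmentation, injectivity makes the larger set
  meet more classes, so it has an element in a class that the smaller set misses.\<close>

lemma matroid_partition:
  assumes "finite E" "U \<subseteq> E"
  shows "matroid E (\<lambda>X. X \<subseteq> U \<and> inj_on p X)"
proof
  fix X Y
  assume X: "X \<subseteq> U \<and> inj_on p X" and Y: "Y \<subseteq> U \<and> inj_on p Y" and "card X < card Y"
  have "finite X"
    using X assms finite_subset[of X E] by blast
  have "\<not> p ` Y \<subseteq> p ` X"
    using X Y \<open>card X < card Y\<close> \<open>finite X\<close> card_mono[of "p ` X" "p ` Y"] by (auto simp: card_image)
  then obtain y where "y \<in> Y" "p y \<notin> p ` X" by blast
  then show "\<exists>y\<in>Y - X. insert y X \<subseteq> U \<and> inj_on p (insert y X)"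
    using X Y by (intro bexI[of _ y] conjI) auto
next
  show "Y \<subseteq> U \<and> inj_on p Y" if "X \<subseteq> U \<and> inj_on p X" "Y \<subseteq> X" for X Y
    using that inj_on_subset[of p X Y] by blast
qed (use assms in auto)

text \<open>Augmentation can only fail by running into \<open>C\<close>. Two one-element extensions
  of the same set differ in a single exchange, so by \<open>far\<close> at most one of them lies in
  \<open>C\<close>; a second candidate then works.\<close>

lemma matroid_sparse_paving:
  assumes "finite E" "U \<subseteq> E" "0 < r"
    and card_C: "\<And>X. X \<in> C \<Longrightarrow> card X = r"
    and far: "\<And>X Y. \<lbrakk>X \<in> C; Y \<in> C; X \<noteq> Y\<rbrakk> \<Longrightarrow> 2 \<le> card (X - Y)"
  shows "matroid E (\<lambda>X. X \<subseteq> U \<and> card X \<le> r \<and> X \<notin> C)"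
proof
  have fin: "finite X" if "X \<subseteq> U" for X
    using that assms finite_subset[of X E] by blast
  show "Y \<subseteq> U \<and> card Y \<le> r \<and> Y \<notin> C" if X: "X \<subseteq> U \<and> card X \<le> r \<and> X \<notin> C" and "Y \<subseteq> X" for X Y
  proof (cases "Y = X")
    case False
    then have "card Y < card X"
      using X \<open>Y \<subseteq> X\<close> fin by (intro psubset_card_mono) auto
    then show ?thesis
      using X \<open>Y \<subseteq> X\<close> card_C by force
  qed (use X in simp)
  fix X Y
  assume X: "X \<subseteq> U \<and> card X \<le> r \<and> X \<notin> C" and Y: "Y \<subseteq> U \<and> card Y \<le> r \<and> Y \<notin> C"
    and lt: "card X < card Y"
  have finX: "finite X" and finY: "finite Y"
    using X Y fin by auto
  obtain y where y: "y \<in> Y" "y \<notin> X"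
    using lt finX by (metis card_mono not_le subsetI)
  have ins: "insert z X \<subseteq> U" "card (insert z X) \<le> r" if "z \<in> Y" for z
    using that X Y lt finX by (auto simp: card_insert_if)
  show "\<exists>y\<in>Y - X. insert y X \<subseteq> U \<and> card (insert y X) \<le> r \<and> insert y X \<notin> C"
  proof (cases "insert y X \<in> C")
    case False
    then show ?thesis using y ins by blast
  next
    case True
    then have r: "r = Suc (card X)"
      using card_C y finX by force
    \<comment> \<open>\<open>Y\<close> and \<open>insert y X\<close> both have size
      \<open>r\<close>, but only the latter is in \<open>C\<close>; hence \<open>Y\<close> supplies
      a second candidate \<open>z\<close>.\<close>
    have "Y \<noteq> insert y X" using True Y by blast
    moreover have "card (insert y X) = card Y"
      using r lt Y y finX by simp
    ultimately have "\<not> Y \<subseteq> insert y X"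
      using finX by (metis card_subset_eq finite_insert)
    then obtain z where z: "z \<in> Y" "z \<notin> X" "z \<noteq> y" by blast
    have "insert z X - insert y X = {z}"
      using z by blast
    then have "insert z X \<notin> C"
      using far[of "insert z X" "insert y X"] True z by auto
    then show ?thesis
      using z ins by blast
  qed
qed (use \<open>finite E\<close> \<open>U \<subseteq> E\<close> \<open>0 < r\<close> card_C[of "{}"] in auto)

subsection \<open>The cube of transversals\<close>

text \<open>The pairs are \<open>h (i, False)\<close>, \<open>h (i, True)\<close> for
  \<open>i \<in> I\<close>. They need not exhaust \<open>E\<close>: the remaining elements become
  loops of both matroids, so \<open>card E\<close> can be arbitrary.\<close>

locale cube =
  fixes E :: "'a set" and I :: "'i set" and h :: "'i \<times> bool \<Rightarrow> 'a"
  assumes finite_E: "finite E" and finite_I: "finite I"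
    and inj_h: "inj_on h (I \<times> UNIV)" and h_in: "h ` (I \<times> UNIV) \<subseteq> E"
begin

definition index :: "'a \<Rightarrow> 'i" where
  "index x = fst (inv_into (I \<times> UNIV) h x)"

text \<open>Encodes a vertex \<open>S\<close> of the cube \<open>Pow I\<close> by choosing one
  element from each pair. Only \<open>S \<inter> I\<close> matters, which is why injectivity is
  stated on \<open>Pow I\<close>.\<close>

definition transversal :: "'i set \<Rightarrow> 'a set" where
  "transversal S = (\<lambda>i. h (i, i \<in> S)) ` I"

definition indep1 :: "'a set \<Rightarrow> bool" where
  "indep1 X \<longleftrightarrow> X \<subseteq> h ` (I \<times> UNIV) \<and> inj_on index X"

text \<open>\<open>H\<close> is the set of deleted cube vertices. Unlike in \<open>indep1\<close>,
  an independent set may contain both elements of a pair.\<close>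

definition indep2 :: "'i set set \<Rightarrow> 'a set \<Rightarrow> bool" where
  "indep2 H X \<longleftrightarrow> X \<subseteq> h ` (I \<times> UNIV) \<and> card X \<le> card I \<and> X \<notin> transversal ` H"

lemma index_h [simp]: "i \<in> I \<Longrightarrow> index (h (i, b)) = i"
  using inj_h by (simp add: index_def)

lemma h_eq_iff [simp]: "\<lbrakk>i \<in> I; j \<in> I\<rbrakk> \<Longrightarrow> h (i, b) = h (j, c) \<longleftrightarrow> i = j \<and> b = c"
  using inj_on_eq_iff[OF inj_h, of "(i, b)" "(j, c)"] by simp

lemma h_in_transversal_iff [simp]: "i \<in> I \<Longrightarrow> h (i, b) \<in> transversal S \<longleftrightarrow> b = (i \<in> S)"
  by (auto simp: transversal_def image_iff)

lemma transversal_subset: "transversal S \<subseteq> h ` (I \<times> UNIV)"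
  by (auto simp: transversal_def)

lemma card_transversal: "card (transversal S) = card I"
  unfolding transversal_def by (intro card_image inj_onI) simp

lemma inj_on_transversal: "inj_on transversal (Pow I)"
proof (rule inj_onI)
  fix S S' assume "S \<in> Pow I" "S' \<in> Pow I" and eq: "transversal S = transversal S'"
  have "i \<in> S \<longleftrightarrow> i \<in> S'" if "i \<in> I" for i
    using h_in_transversal_iff[OF that, of True] eq by metis
  then show "S = S'"
    using \<open>S \<in> Pow I\<close> \<open>S' \<in> Pow I\<close> by auto
qed

text \<open>Exchange distance is Hamming distance, since the transversals differ exactly at the
  indices in \<open>sym_diff S S'\<close>. Single exchanges are thus the edges of the cube.\<close>

lemma card_transversal_diff:
  assumes "S \<subseteq> I" "S' \<subseteq> I"
  shows "card (transversal S - transversal S') = card (sym_diff S S')"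
proof -
  have "transversal S - transversal S' = (\<lambda>i. h (i, i \<in> S)) ` sym_diff S S'"
    using assms by (auto simp: transversal_def image_iff)
  moreover have "inj_on (\<lambda>i. h (i, i \<in> S)) (sym_diff S S')"
    by (rule inj_on_subset[of _ I]) (use assms in \<open>auto intro: inj_onI\<close>)
  ultimately show ?thesis
    by (simp add: card_image)
qed

lemma finite_if_covered: "X \<subseteq> h ` (I \<times> UNIV) \<Longrightarrow> finite X"
  using finite_I by (auto elim: finite_subset)

section \<open>The two matroids and their common bases\<close>

lemma matroid_indep1: "matroid E indep1"
  using matroid_partition[OF finite_E h_in, of index] by (simp add: indep1_def[abs_def])

text \<open>Distinct sets of equal size are incomparable, so they differ in at least two indices, as
  sparse paving requires. Any part of a level is allowed, to cover both the full and the punctured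
  level.\<close>

lemma matroid_indep2:
  assumes "I \<noteq> {}" and H: "H \<subseteq> {S. S \<subseteq> I \<and> card S = k}"
  shows "matroid E (indep2 H)"
  unfolding indep2_def[abs_def]
proof (rule matroid_sparse_paving[OF finite_E h_in])
  show "0 < card I"
    using assms(1) finite_I by (simp add: card_gt_0_iff)
  show "card X = card I" if "X \<in> transversal ` H" for X
    using that card_transversal by auto
  fix X Y assume "X \<in> transversal ` H" "Y \<in> transversal ` H" "X \<noteq> Y"
  then obtain S S' where XY: "X = transversal S" "Y = transversal S'"
    and "S \<in> H" "S' \<in> H" "S \<noteq> S'"
    by blast
  then have S: "S \<subseteq> I" "card S = k" and S': "S' \<subseteq> I" "card S' = k"
    using H by auto
  have fin: "finite S" "finite S'"
    using S(1) S'(1) finite_subset[OF _ finite_I] by auto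
  have "\<not> S \<subseteq> S'" "\<not> S' \<subseteq> S"
    using \<open>S \<noteq> S'\<close> S(2) S'(2) card_subset_eq[OF fin(1), of S'] card_subset_eq[OF fin(2), of S] by auto
  then obtain i j where "i \<in> S - S'" "j \<in> S' - S" by blast
  then have "i \<noteq> j" "{i, j} \<subseteq> sym_diff S S'" by auto
  then have "card {i, j} = 2" by simp
  with \<open>{i, j} \<subseteq> sym_diff S S'\<close> have "2 \<le> card (sym_diff S S')"
    using fin card_mono[of "sym_diff S S'" "{i, j}"] by simp
  then show "2 \<le> card (X - Y)"
    using S S' XY card_transversal_diff by simp
qed

lemma indep1_transversal: "indep1 (transversal S)"
  unfolding indep1_def
  by (intro conjI transversal_subset inj_onI) (auto simp: transversal_def)

lemma card_indep1: "indep1 X \<Longrightarrow> finite X \<and> card X \<le> card I"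
proof -
  assume X: "indep1 X"
  then have "finite X"
    using finite_if_covered unfolding indep1_def by blast
  moreover have "index ` X \<subseteq> I"
    using X by (auto simp: indep1_def)
  then have "card X \<le> card I"
    using X finite_I by (metis card_image card_mono indep1_def)
  ultimately show ?thesis ..
qed

lemma basis_indep1_transversal:
  assumes "basis indep1 X"
  obtains S where "S \<subseteq> I" "X = transversal S"
proof -
  have max: "Y = X" if "indep1 Y" "X \<subseteq> Y" for Y
    using assms that unfolding basis_def by blast
  have X: "X \<subseteq> h ` (I \<times> UNIV)" "inj_on index X"
    using assms by (simp_all add: basis_def indep1_def)
  \<comment> \<open>The witness takes the \<open>True\<close> element where \<open>X\<close> does
    and the \<open>False\<close> element otherwise, thereby also filling pairs that \<open>X\<close>
    misses. Maximality of \<open>X\<close> then forces equality.\<close>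
  have "X \<subseteq> transversal {i \<in> I. h (i, True) \<in> X}"
  proof
    fix x assume "x \<in> X"
    then obtain i b where ib: "i \<in> I" "x = h (i, b)"
      using X(1) by auto
    have "h (i, True) = x" if "h (i, True) \<in> X"
      using that ib \<open>x \<in> X\<close> by (intro inj_onD[OF X(2)]) simp_all
    then have "b = (h (i, True) \<in> X)"
      using ib \<open>x \<in> X\<close> by (cases b) auto
    then show "x \<in> transversal {i \<in> I. h (i, True) \<in> X}"
      using ib by simp
  qed
  then have "X = transversal {i \<in> I. h (i, True) \<in> X}"
    by (rule max[OF indep1_transversal, symmetric])
  then show thesis by (rule that[rotated]) blast
qed

lemma common_basis_iff:
  assumes "H \<subseteq> Pow I"
  shows "common_basis indep1 (indep2 H) X \<longleftrightarrow> (\<exists>S. S \<subseteq> I \<and> S \<notin> H \<and> X = transversal S)"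
proof
  assume X: "common_basis indep1 (indep2 H) X"
  then obtain S where "S \<subseteq> I" "X = transversal S"
    using basis_indep1_transversal by (auto simp: common_basis_def)
  moreover have "X \<notin> transversal ` H"
    using X unfolding common_basis_def basis_def indep2_def by blast
  ultimately show "\<exists>S. S \<subseteq> I \<and> S \<notin> H \<and> X = transversal S"
    by blast
next
  assume "\<exists>S. S \<subseteq> I \<and> S \<notin> H \<and> X = transversal S"
  then obtain S where S: "S \<subseteq> I" "S \<notin> H" "X = transversal S" by blast
  have "transversal S \<notin> transversal ` H"
    using S assms by (simp add: inj_on_image_mem_iff[OF inj_on_transversal])
  then have "indep2 H X"
    using S by (simp add: indep2_def transversal_subset card_transversal)
  moreover have "indep1 X"
    using S indep1_transversal by simp
  \<comment> \<open>A transversal attains the size bound \<open>card I\<close> valid in both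
    matroids, so this one fact gives maximality in each.\<close>
  moreover have "Y = X" if "finite Y \<and> card Y \<le> card I" "X \<subseteq> Y" for Y
    using that S card_transversal[of S] card_seteq[of Y X] by simp
  moreover have "finite Y \<and> card Y \<le> card I" if "indep2 H Y" for Y
    using that finite_if_covered unfolding indep2_def by blast
  ultimately show "common_basis indep1 (indep2 H) X"
    unfolding common_basis_def basis_def using card_indep1 by blast
qed

lemma common_basis_transversal_iff:
  assumes "H \<subseteq> Pow I" "S \<subseteq> I"
  shows "common_basis indep1 (indep2 H) (transversal S) \<longleftrightarrow> S \<notin> H"
proof -
  have "S = R" if "R \<subseteq> I" "transversal S = transversal R" for R
    using inj_onD[OF inj_on_transversal] that assms(2) by blast
  then show ?thesis
    unfolding common_basis_iff[OF assms(1)] using assms(2) by blast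
qed

section \<open>Connectivity of the cube with deleted vertices\<close>

lemma transversal_step:
  assumes "H \<subseteq> Pow I" "i \<in> I" "i \<notin> S" "insert i S \<subseteq> I" "S \<notin> H" "insert i S \<notin> H"
  shows "reconfigurable indep1 (indep2 H) (transversal S) (transversal (insert i S))"
proof (rule reconfigurable_step)
  have "sym_diff S (insert i S) = {i}" "sym_diff (insert i S) S = {i}"
    using assms by auto
  then show "card (transversal S - transversal (insert i S)) = 1"
    "card (transversal (insert i S) - transversal S) = 1"
    using assms by (simp_all add: card_transversal_diff)
  show "common_basis indep1 (indep2 H) (transversal (insert i S))"
    using assms by (simp add: common_basis_transversal_iff)
  show "reconfigurable indep1 (indep2 H) (transversal S) (transversal S)"
    using assms by (intro reconfigurable_refl) (simp add: common_basis_transversal_iff)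
qed

text \<open>Adding the elements of \<open>S' - S\<close> one at a time stays in the interval from
  \<open>S\<close> to \<open>S'\<close>, which contains no deleted vertex.\<close>

lemma reconfigurable_chain:
  assumes "H \<subseteq> Pow I" "S \<subseteq> S'" "S' \<subseteq> I" and avoid: "\<And>R. \<lbrakk>S \<subseteq> R; R \<subseteq> S'\<rbrakk> \<Longrightarrow> R \<notin> H"
  shows "reconfigurable indep1 (indep2 H) (transversal S) (transversal S')"
proof -
  have "finite D \<Longrightarrow> D \<subseteq> S' - S \<Longrightarrow>
    reconfigurable indep1 (indep2 H) (transversal S) (transversal (S \<union> D))" for D
  proof (induction D rule: finite_induct)
    case empty
    show ?case
      using assms avoid[of S] by (auto intro!: reconfigurable_refl simp: common_basis_transversal_iff)
  next
    case (insert i D)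
    have "reconfigurable indep1 (indep2 H) (transversal (S \<union> D)) (transversal (insert i (S \<union> D)))"
      using insert assms by (intro transversal_step avoid) auto
    then show ?case
      using insert reconfigurable_trans by fastforce
  qed
  from this[of "S' - S"] show ?thesis
    using assms(2,3) finite_I by (simp add: Un_absorb1 finite_subset)
qed

text \<open>A step changes the level by at most one, so a sequence starting at the bottom cannot
  jump over the deleted level \<open>k\<close>.\<close>

lemma not_reconfigurable_level:
  assumes k: "k < card I" and H: "H = {S. S \<subseteq> I \<and> card S = k}"
  shows "\<not> reconfigurable indep1 (indep2 H) (transversal {}) (transversal I)"
proof
  have HI: "H \<subseteq> Pow I" using H by blast
  \<comment> \<open>The weak bound is enough: avoiding level \<open>k\<close> makes it strict for a
    common basis, and one step then restores at most \<open>k\<close>.\<close>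
  define P where "P X \<longleftrightarrow> (\<exists>S. S \<subseteq> I \<and> card S \<le> k \<and> X = transversal S)" for X
  assume "reconfigurable indep1 (indep2 H) (transversal {}) (transversal I)"
  then have "P (transversal I)"
  proof (rule reconfigurable_invariant)
    show "P (transversal {})"
      unfolding P_def by (rule exI[of _ "{}"]) simp
    fix C D
    assume "P C" and C: "common_basis indep1 (indep2 H) C" and D: "common_basis indep1 (indep2 H) D"
      and CD: "card (C - D) = 1"
    from \<open>P C\<close> obtain S where S: "S \<subseteq> I" "card S \<le> k" "C = transversal S"
      unfolding P_def by blast
    have "S \<notin> H"
      using C S HI by (simp add: common_basis_transversal_iff)
    then have lt: "card S < k"
      using S unfolding H by fastforce
    obtain R where R: "R \<subseteq> I" "D = transversal R"
      using D unfolding common_basis_iff[OF HI] by blast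
    have "card (sym_diff S R) = 1"
      using CD S R card_transversal_diff by simp
    have fin: "finite S" "finite R"
      using S(1) R(1) finite_subset[OF _ finite_I] by auto
    have "card R \<le> card (S \<union> sym_diff S R)"
      using fin by (intro card_mono) auto
    also have "\<dots> \<le> card S + card (sym_diff S R)"
      by (rule card_Un_le)
    finally have "card R \<le> k"
      using lt \<open>card (sym_diff S R) = 1\<close> by simp
    then show "P D"
      using R unfolding P_def by blast
  qed
  then obtain S where "S \<subseteq> I" "card S \<le> k" "transversal I = transversal S"
    unfolding P_def by blast
  then have "S = I"
    using inj_onD[OF inj_on_transversal] by blast
  then show False
    using \<open>card S \<le> k\<close> k by simp
qed

text \<open>The restored vertex \<open>S0\<close> is a gate joining the two halves: it is reachable
  from \<open>{}\<close> below and leads to \<open>I\<close> above.\<close>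

lemma RCB_punctured_level:
  assumes S0: "S0 \<subseteq> I" "card S0 = k" and H: "H = {S. S \<subseteq> I \<and> card S = k} - {S0}"
  shows "RCB indep1 (indep2 H)"
proof -
  let ?rec = "reconfigurable indep1 (indep2 H)"
  have HI: "H \<subseteq> Pow I" using H by blast
  have fin: "finite S" if "S \<subseteq> I" for S
    using that finite_subset[OF _ finite_I] by blast
  \<comment> \<open>Proper subsets of \<open>S0\<close> lie below level \<open>k\<close>, so the
    interval from \<open>{}\<close> to \<open>S0\<close> also avoids \<open>H\<close>.\<close>
  have below: "?rec (transversal {}) (transversal S)" if "S \<subseteq> I" "card S < k \<or> S = S0" for S
  proof (rule reconfigurable_chain[OF HI _ \<open>S \<subseteq> I\<close>])
    fix R assume "R \<subseteq> S"
    then have "card R \<le> card S" "card R = card S \<Longrightarrow> R = S"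
      using card_mono[of S R] card_subset_eq[of S R] fin[OF \<open>S \<subseteq> I\<close>] by blast+
    moreover have "card R = k \<and> R \<noteq> S0" if "R \<in> H"
      using that unfolding H by blast
    ultimately show "R \<notin> H"
      using that(2) S0(2) by (metis leD)
  qed simp
  have above: "?rec (transversal S) (transversal I)" if "S \<subseteq> I" "k < card S \<or> S = S0" for S
  proof (rule reconfigurable_chain[OF HI \<open>S \<subseteq> I\<close>])
    fix R assume "S \<subseteq> R" "R \<subseteq> I"
    then have "card S \<le> card R" "card S = card R \<Longrightarrow> S = R"
      using card_mono[of R S] card_subset_eq[of R S] fin[OF \<open>R \<subseteq> I\<close>] by blast+
    moreover have "card R = k \<and> R \<noteq> S0" if "R \<in> H"
      using that unfolding H by blast
    ultimately show "R \<notin> H"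
      using that(2) S0(2) by (metis leD)
  qed simp
  \<comment> \<open>\<open>{}\<close> serves as hub; vertices above level \<open>k\<close> are
    reached through \<open>S0\<close> and then down from \<open>I\<close>.\<close>
  have from_empty: "?rec (transversal {}) (transversal S)" if "S \<subseteq> I" "S \<notin> H" for S
  proof (cases "card S < k \<or> S = S0")
    case False
    moreover have "card S \<noteq> k \<or> S = S0"
      using that unfolding H by blast
    ultimately have "k < card S \<or> S = S0"
      by linarith
    then have "?rec (transversal I) (transversal S)"
      by (rule reconfigurable_sym[OF above[OF that(1)]])
    moreover have "?rec (transversal {}) (transversal I)"
      using reconfigurable_trans[OF below[OF S0(1)] above[OF S0(1)]] by simp
    ultimately show ?thesis
      by (rule reconfigurable_trans[rotated])
  qed (rule below[OF that(1)])
  show ?thesis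
    unfolding RCB_def common_basis_iff[OF HI]
  proof (intro allI impI, elim exE conjE)
    fix B B' S S'
    assume "S \<subseteq> I" "S \<notin> H" "B = transversal S" "S' \<subseteq> I" "S' \<notin> H" "B' = transversal S'"
    then show "?rec B B'"
      using reconfigurable_trans[OF reconfigurable_sym[OF from_empty] from_empty] by simp
  qed
qed

text \<open>Restoring a vertex alters the oracle at a single set, as the adversary argument
  demands.\<close>

lemma indep2_remove:
  assumes "H \<subseteq> Pow I" "S \<in> H" "Y \<noteq> transversal S"
  shows "indep2 (H - {S}) Y = indep2 H Y"
  using assms by (auto simp: indep2_def)

end

section \<open>Hard instances and the query bounds\<close>

text \<open>One family serves both problems. \<open>B\<close> and \<open>B'\<close> stay common
  bases for every \<open>J\<close>, because they are input on which the decision tree may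
  depend.\<close>

lemma exists_hard_instances:
  fixes E :: "'a set"
  assumes "finite E" and card_E: "4 \<le> card E"
  obtains I1 I2 B B' F where
    "matroid E I1" "matroid E I2" "common_basis I1 I2 B" "common_basis I1 I2 B'"
    "\<not> reconfigurable I1 I2 B B'" "(21 / 20) ^ card E \<le> real (card F)"
    "\<And>X. X \<in> F \<Longrightarrow> \<exists>J. matroid E J \<and> (\<forall>Y. Y \<noteq> X \<longrightarrow> J Y = I2 Y) \<and> RCB I1 J \<and>
       common_basis I1 J B \<and> common_basis I1 J B'"
proof -
  \<comment> \<open>The \<open>2 * m\<close> pairs occupy \<open>4 * m\<close> elements, leaving at
    most three loops.\<close>
  define m where "m = card E div 4"
  define I where "I = {..<2 * m}"
  have m: "0 < m" "4 * m \<le> card E"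
    using card_E unfolding m_def by auto
  have card_I: "card I = 2 * m" "finite I" "I \<noteq> {}"
    using m by (auto simp: I_def lessThan_empty_iff)
  have "card (I \<times> (UNIV :: bool set)) = 4 * m"
    by (simp add: card_I card_cartesian_product)
  then obtain h :: "nat \<times> bool \<Rightarrow> 'a" where h: "inj_on h (I \<times> UNIV)" "h ` (I \<times> UNIV) \<subseteq> E"
    using card_le_inj[of "I \<times> (UNIV :: bool set)" E] \<open>finite E\<close> card_I m by auto
  interpret cube E I h
    using h \<open>finite E\<close> card_I by unfold_locales auto
  define H where "H = {S. S \<subseteq> I \<and> card S = m}"
  have HI: "H \<subseteq> Pow I" unfolding H_def by blast
  \<comment> \<open>The base \<open>21 / 20\<close> is chosen so that its eighth power is at most 2:
    this reduces the bound to \<open>2 ^ m\<close>, which is at most the central binomial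
    coefficient.\<close>
  have "card E \<le> 8 * m"
    using card_E unfolding m_def by presburger
  then have "(21 / 20) ^ card E \<le> (21 / 20 :: real) ^ (8 * m)"
    by (intro power_increasing) auto
  also have "\<dots> = ((21 / 20) ^ 8) ^ m"
    by (rule power_mult)
  also have "\<dots> \<le> 2 ^ m"
    by (intro power_mono) (auto simp: power_divide)
  also have "\<dots> \<le> real (2 * m choose m)"
    using binomial_ge_n_over_k_pow_k[of m "2 * m", where 'a = real] m by simp
  also have "2 * m choose m = card H"
    using n_subsets[of I m] card_I unfolding H_def by simp
  also have "\<dots> = card (transversal ` H)"
    using inj_on_subset[OF inj_on_transversal HI] by (simp add: card_image)
  finally have card_F: "(21 / 20) ^ card E \<le> real (card (transversal ` H))" .
  have ends: "{} \<notin> H" "I \<notin> H"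
    using m card_I unfolding H_def by auto
  show thesis
  proof (rule that[OF matroid_indep1 matroid_indep2[of H m] _ _ not_reconfigurable_level[of m H] card_F])
    fix X assume "X \<in> transversal ` H"
    then obtain S where S: "S \<in> H" "X = transversal S" by blast
    have HI': "H - {S} \<subseteq> Pow I" using HI by blast
    show "\<exists>J. matroid E J \<and> (\<forall>Y. Y \<noteq> X \<longrightarrow> J Y = indep2 H Y) \<and> RCB indep1 J \<and>
       common_basis indep1 J (transversal {}) \<and> common_basis indep1 J (transversal I)"
    proof (intro exI[of _ "indep2 (H - {S})"] conjI allI impI)
      show "matroid E (indep2 (H - {S}))"
        using card_I by (intro matroid_indep2[of _ m]) (auto simp: H_def)
      show "RCB indep1 (indep2 (H - {S}))"
        using S by (intro RCB_punctured_level[of S m]) (auto simp: H_def)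
    qed (use S HI ends in \<open>auto simp: indep2_remove common_basis_transversal_iff[OF HI']\<close>)
  qed (use card_I m ends HI in \<open>auto simp: H_def common_basis_transversal_iff\<close>)
qed

theorem theorem8p1:
  "(\<exists>c::real. c > 1 \<and> (\<exists>N::nat. \<forall>E::'a set. finite E \<longrightarrow> card E \<ge> N \<longrightarrow>
      (\<forall>A. solves_RCB_testing E A \<longrightarrow>
        (\<exists>I1 I2. matroid E I1 \<and> matroid E I2 \<and>
           real (num_queries I1 I2 A) \<ge> c ^ card E)))) \<and>
   (\<exists>c::real. c > 1 \<and> (\<exists>N::nat. \<forall>E::'a set. finite E \<longrightarrow> card E \<ge> N \<longrightarrow>
      (\<forall>A. solves_matroid_intersection_reconfiguration E A \<longrightarrow>
        (\<exists>I1 I2 B B'. matroid E I1 \<and> matroid E I2 \<and>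
           common_basis I1 I2 B \<and> common_basis I1 I2 B' \<and>
           real (num_queries I1 I2 (A B B')) \<ge> c ^ card E))))"
proof (intro conjI exI[of _ "21 / 20 :: real"] exI[of _ "4 :: nat"] allI impI)
  fix E :: "'a set" and A
  assume E: "finite E" "4 \<le> card E" and A: "solves_RCB_testing E A"
  obtain I1 I2 B B' F where *: "matroid E I1" "matroid E I2"
    "common_basis I1 I2 B" "common_basis I1 I2 B'" "\<not> reconfigurable I1 I2 B B'"
    "(21 / 20) ^ card E \<le> real (card F)"
    and F: "\<And>X. X \<in> F \<Longrightarrow> \<exists>J. matroid E J \<and> (\<forall>Y. Y \<noteq> X \<longrightarrow> J Y = I2 Y) \<and> RCB I1 J \<and>
       common_basis I1 J B \<and> common_basis I1 J B'"
    using exists_hard_instances[OF E] by metis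
  \<comment> \<open>\<open>B\<close> and \<open>B'\<close> refute (RCB) for \<open>I1\<close>,
    \<open>I2\<close>, whereas every modified instance satisfies it.\<close>
  have "\<not> answer I1 I2 A"
    using A * unfolding solves_RCB_testing_def RCB_def by blast
  moreover have "answer I1 J A" if "matroid E J" "RCB I1 J" for J
    using A * that unfolding solves_RCB_testing_def by blast
  ultimately have "card F \<le> num_queries I1 I2 A"
    using F by (intro card_le_num_queries) metis
  then show "\<exists>I1 I2. matroid E I1 \<and> matroid E I2 \<and>
      real (num_queries I1 I2 A) \<ge> (21 / 20) ^ card E"
    using * by (meson of_nat_mono order_trans)
next
  fix E :: "'a set" and A
  assume E: "finite E" "4 \<le> card E" and A: "solves_matroid_intersection_reconfiguration E A"
  obtain I1 I2 B B' F where *: "matroid E I1" "matroid E I2"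
    "common_basis I1 I2 B" "common_basis I1 I2 B'" "\<not> reconfigurable I1 I2 B B'"
    "(21 / 20) ^ card E \<le> real (card F)"
    and F: "\<And>X. X \<in> F \<Longrightarrow> \<exists>J. matroid E J \<and> (\<forall>Y. Y \<noteq> X \<longrightarrow> J Y = I2 Y) \<and> RCB I1 J \<and>
       common_basis I1 J B \<and> common_basis I1 J B'"
    using exists_hard_instances[OF E] by metis
  \<comment> \<open>With \<open>B\<close> and \<open>B'\<close> fixed, the single tree
    \<open>A B B'\<close> runs on all these instances, so the adversary argument applies to
    it.\<close>
  have "\<not> answer I1 I2 (A B B')"
    using A * unfolding solves_matroid_intersection_reconfiguration_def by blast
  moreover have "answer I1 J (A B B')"
    if "matroid E J" "RCB I1 J" "common_basis I1 J B" "common_basis I1 J B'" for J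
    using A * that unfolding solves_matroid_intersection_reconfiguration_def RCB_def by blast
  ultimately have "card F \<le> num_queries I1 I2 (A B B')"
    using F by (intro card_le_num_queries) metis
  then show "\<exists>I1 I2 B B'. matroid E I1 \<and> matroid E I2 \<and>
      common_basis I1 I2 B \<and> common_basis I1 I2 B' \<and>
      real (num_queries I1 I2 (A B B')) \<ge> (21 / 20) ^ card E"
    using * by (meson of_nat_mono order_trans)
qed simp_all

end
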